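(* Let $m\in\mathbb{N}$ be an even positive integer and let $K\subset\mathbb{R}^2$ be a polygon with $N$ edges. Let $\{\pi_n\}_{n\in\mathbb{N}_0}$ be a sequence of orthogonal polynomials on $[-1,1]$ with respect to a weight function $\omega$, with $\pi_n(t)=\sum_{\nu=0}^n\gamma_\nu^{(n)}t^\nu$. For any interval $[a,b]$, let $\pi_{n,a,b}(x)=\pi_n(\varphi(x))$, $n\in\mathbb{N}_0$, denote the corresponding rescaled polynomials on $[a,b]$, where $\varphi(x)=\frac{a+b-2x}{a-b}$. Then the following statements are equivalent: (1) The triple $\mathcal A_{m,N}$ (built with the interval $[a,b]$ and the weight $\omega\circ\varphi$) defines a finite element; (2) $\pi_{m,a,b}(b)-\pi_{m,a,b}(a)\neq0$; (3) The polynomial $\pi_{m,a,b}'$ is not orthogonal to the constant functions on $[a,b]$ with respect to the constant weight function $1$, i.e. $\int_a^b\pi_{m,a,b}'(x)\,dx\ne0$; (4) $\displaystyle\sum_{\substack{\nu=0\\ \nu\ \mathrm{odd}}}^m\gamma_\nu^{(m)}\neq0$.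
   Context: $\mathbb{N}=\{1,2,\dots\}$, $\mathbb{N}_0=\mathbb{N}\cup\{0\}$, $a<b$ are real numbers. A weight function on a bounded interval is a nonnegative integrable function with strictly positive integral and finite moments. A sequence of real polynomials $\{\pi_n\}_{n\in\mathbb{N}_0}$ is orthogonal on an interval with respect to $\omega$ if $\deg\pi_n=n$ and $\int\pi_m\pi_n\omega=K_n\delta_{mn}$ with $K_n\ne0$. The affine map $\varphi$ sends $[a,b]$ onto $[-1,1]$, and $\{\pi_{n,a,b}\}$ is orthogonal on $[a,b]$ with respect to $\omega\circ\varphi$. $K$ has vertices $\mathbf v_1,\dots,\mathbf v_N$ ordered counter-clockwise, edges $e_i=[\mathbf v_i,\mathbf v_{i+1}]$, $\mathbf v_{N+1}=\mathbf v_1$. With $\psi_i(x)=\frac{b-x}{b-a}\mathbf v_i+\frac{x-a}{b-a}\mathbf v_{i+1}$, $x\in[a,b]$, put $\widetilde\gamma_i(u)(x)=u|_{e_i}(\psi_i(x))$. $\mathcal{S}_m(\partial K)$ is the space of $f\in L^2(\partial K)$ such that $f|_{e_i}$ is a polynomial of degree at most $m$ for each $i$ (no continuity at vertices), and $\mathcal{S}_m^0(\partial K)=\mathcal{S}_m(\partial K)\cap C^0(\partial K)$, of dimension $mN$. Given a basis $\{b_j\}_{j=1}^{mN}$ of $\mathcal{S}_{m-1}(\partial K)$, the triple built with $[a,b]$ and a weight $w$ on $[a,b]$ is $\mathcal A_{m,N}=(\partial K,\mathcal{S}_m^0(\partial K),\Sigma_{\partial K})$, $\Sigma_{\partial K}=\{\mathcal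 L_j\}_{j=1}^{mN}$, $\mathcal L_j(f)=\sum_{i=1}^N\int_a^b\widetilde\gamma_i(f)\widetilde\gamma_i(b_j)\,w\,dx$. It "defines a finite element" if the only $p\in\mathcal{S}_m^0(\partial K)$ with $\mathcal L_j(p)=0$ for all $j$ is $p=0$. *)

theory Defs
  imports "HOL-Analysis.Analysis"
begin

definition weight_function :: "real \<Rightarrow> real \<Rightarrow> (real \<Rightarrow> real) \<Rightarrow> bool" where
  "weight_function l r w \<longleftrightarrow>
     (\<forall>t\<in>{l..r}. 0 \<le> w t) \<and>
     set_integrable lebesgue {l..r} w \<and>
     0 < (LINT t:{l..r}|lebesgue. w t) \<and>
     (\<forall>k::nat. set_integrable lebesgue {l..r} (\<lambda>t. t ^ k * w t))"

definition orthogonal_polys ::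
    "real \<Rightarrow> real \<Rightarrow> (real \<Rightarrow> real) \<Rightarrow> (nat \<Rightarrow> real poly) \<Rightarrow> bool" where
  "orthogonal_polys l r w p \<longleftrightarrow>
     (\<forall>n. degree (p n) = n) \<and>
     (\<exists>K :: nat \<Rightarrow> real. (\<forall>n. K n \<noteq> 0) \<and>
        (\<forall>m n. (LINT t:{l..r}|lebesgue. poly (p m) t * poly (p n) t * w t)
                 = (if m = n then K n else 0)))"

definition rescale :: "real \<Rightarrow> real \<Rightarrow> real \<Rightarrow> real" where
  "rescale a b x = (a + b - 2 * x) / (a - b)"

definition rescaled_poly :: "(nat \<Rightarrow> real poly) \<Rightarrow> nat \<Rightarrow> real \<Rightarrow> real \<Rightarrow> real \<Rightarrow> real" where
  "rescaled_poly p n a b x = poly (p n) (rescale a b x)"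

definition edge :: "(nat \<Rightarrow> real^2) \<Rightarrow> nat \<Rightarrow> (real^2) set" where
  "edge v i = closed_segment (v i) (v (Suc i))"

text \<open>Vertices are indexed by \<open>{1..N}\<close>, with \<open>v (Suc N)\<close> repeating \<open>v 1\<close>. The edges form a simple
  closed curve: distinct edges meet exactly in their common end points. By the Jordan curve
  theorem, a compact set with nonempty interior whose frontier is that curve is the curve
  together with its inside. For a simple closed polygonal line, the vertices are in
  counter-clockwise order iff the shoelace sum (twice the signed area) is positive.\<close>

definition polygon :: "nat \<Rightarrow> (nat \<Rightarrow> real^2) \<Rightarrow> (real^2) set \<Rightarrow> bool" where
  "polygon N v K \<longleftrightarrow>
     3 \<le> N \<and> v (Suc N) = v 1 \<and> inj_on v {1..N} \<and>
     (\<forall>i\<in>{1..N}. \<forall>j\<in>{1..N}. i \<noteq> j \<longrightarrow>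
        edge v i \<inter> edge v j = {v i, v (Suc i)} \<inter> {v j, v (Suc j)}) \<and>
     compact K \<and> interior K \<noteq> {} \<and> frontier K = (\<Union>i\<in>{1..N}. edge v i) \<and>
     0 < (\<Sum>i=1..N. v i $ 1 * v (Suc i) $ 2 - v i $ 2 * v (Suc i) $ 1)"

text \<open>Arc length measure on the boundary: push forward Lebesgue measure on \<open>[0,1]\<close>, scaled by the
  length of the edge, along each of the \<open>N\<close> edges. Edges overlap only in vertices, so nothing is
  counted twice.\<close>

definition boundary_measure :: "nat \<Rightarrow> (nat \<Rightarrow> real^2) \<Rightarrow> (real^2) set \<Rightarrow> (real^2) measure" where
  "boundary_measure N v K =
     distr
       (density (count_space {1..N} \<Otimes>\<^sub>M restrict_space lborel {0..1})
          (\<lambda>(i, t). ennreal (dist (v i) (v (Suc i)))))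
       (restrict_space borel (frontier K))
       (\<lambda>(i, t). linepath (v i) (v (Suc i)) t)"

text \<open>Elements of the Lebesgue space \<open>L\<^sup>2\<close> of the boundary are represented by functions on the plane
  of which only the values on \<open>frontier K\<close> matter, and whose equality in \<open>L\<^sup>2\<close> is equality almost
  everywhere with respect to arc length.\<close>

definition boundary_L2 ::
    "nat \<Rightarrow> (nat \<Rightarrow> real^2) \<Rightarrow> (real^2) set \<Rightarrow> (real^2 \<Rightarrow> real) set" where
  "boundary_L2 N v K =
     {f \<in> borel_measurable (boundary_measure N v K).
        integrable (boundary_measure N v K) (\<lambda>x. (f x)\<^sup>2)}"

text \<open>A polynomial of degree at most \<open>m\<close> on an edge is a univariate polynomial of degree at most
  \<open>m\<close> in an affine parameter of the edge.\<close>

definition piecewise_poly ::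
    "nat \<Rightarrow> nat \<Rightarrow> (nat \<Rightarrow> real^2) \<Rightarrow> (real^2) set \<Rightarrow> (real^2 \<Rightarrow> real) set" where
  "piecewise_poly m N v K =
     {f \<in> boundary_L2 N v K.
        \<forall>i\<in>{1..N}. \<exists>p :: real poly. degree p \<le> m \<and>
          (AE t in lborel. t \<in> {0..1} \<longrightarrow> f (linepath (v i) (v (Suc i)) t) = poly p t)}"

definition piecewise_poly_cont ::
    "nat \<Rightarrow> nat \<Rightarrow> (nat \<Rightarrow> real^2) \<Rightarrow> (real^2) set \<Rightarrow> (real^2 \<Rightarrow> real) set" where
  "piecewise_poly_cont m N v K =
     {f \<in> piecewise_poly m N v K. continuous_on (frontier K) f}"

definition basis_AE ::
    "'a measure \<Rightarrow> ('a \<Rightarrow> real) set \<Rightarrow> nat \<Rightarrow> (nat \<Rightarrow> 'a \<Rightarrow> real) \<Rightarrow> bool" where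
  "basis_AE M V d bs \<longleftrightarrow>
     (\<forall>j\<in>{1..d}. bs j \<in> V) \<and>
     (\<forall>c :: nat \<Rightarrow> real. (AE x in M. (\<Sum>j=1..d. c j * bs j x) = 0) \<longrightarrow> (\<forall>j\<in>{1..d}. c j = 0)) \<and>
     (\<forall>f\<in>V. \<exists>c :: nat \<Rightarrow> real. AE x in M. f x = (\<Sum>j=1..d. c j * bs j x))"

definition edge_param :: "real \<Rightarrow> real \<Rightarrow> (nat \<Rightarrow> real^2) \<Rightarrow> nat \<Rightarrow> real \<Rightarrow> real^2" where
  "edge_param a b v i x = ((b - x) / (b - a)) *\<^sub>R v i + ((x - a) / (b - a)) *\<^sub>R v (Suc i)"

definition edge_trace ::
    "real \<Rightarrow> real \<Rightarrow> (nat \<Rightarrow> real^2) \<Rightarrow> nat \<Rightarrow> (real^2 \<Rightarrow> real) \<Rightarrow> real \<Rightarrow> real" where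
  "edge_trace a b v i u x = u (edge_param a b v i x)"

definition dof ::
    "nat \<Rightarrow> (nat \<Rightarrow> real^2) \<Rightarrow> real \<Rightarrow> real \<Rightarrow> (real \<Rightarrow> real) \<Rightarrow> (real^2 \<Rightarrow> real) \<Rightarrow>
     (real^2 \<Rightarrow> real) \<Rightarrow> real" where
  "dof N v a b w g f =
     (\<Sum>i=1..N. LINT x:{a..b}|lebesgue. edge_trace a b v i f x * edge_trace a b v i g x * w x)"

type_synonym 'a fe_triple = "'a set \<times> ('a \<Rightarrow> real) set \<times> (('a \<Rightarrow> real) \<Rightarrow> real) set"

definition element_triple ::
    "nat \<Rightarrow> nat \<Rightarrow> (nat \<Rightarrow> real^2) \<Rightarrow> (real^2) set \<Rightarrow> real \<Rightarrow> real \<Rightarrow> (real \<Rightarrow> real) \<Rightarrow>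
     (nat \<Rightarrow> real^2 \<Rightarrow> real) \<Rightarrow> (real^2) fe_triple" where
  "element_triple m N v K a b w bs =
     (frontier K, piecewise_poly_cont m N v K, (\<lambda>j. dof N v a b w (bs j)) ` {1..m * N})"

text \<open>The function space of the triple consists of continuous functions, so \<open>p = 0\<close> is equality on
  the whole domain.\<close>

fun defines_finite_element :: "'a fe_triple \<Rightarrow> bool" where
  "defines_finite_element (D, P, \<Sigma>) \<longleftrightarrow>
     (\<forall>p\<in>P. (\<forall>L\<in>\<Sigma>. L p = 0) \<longrightarrow> (\<forall>x\<in>D. p x = 0))"

end

theory Submission
  imports Defs
begin

text \<open>
  Each edge is parametrised affinely by the reference interval \<open>[-1, 1]\<close>. There, an element of the
  continuous space restricts to a polynomial of degree at most \<open>m\<close>. The degrees of freedom test the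
  restrictions against all piecewise polynomials of degree below \<open>m\<close>, in particular against those
  supported on one edge. Hence all of them vanish on \<open>f\<close> iff on every edge \<open>i\<close> the restriction
  of \<open>f\<close> is orthogonal to all lower degrees, i.e. equals \<open>c\<^sub>i \<pi>\<^sub>m\<close>
  (\<open>dof_zero_imp_pullback_multiple\<close>).

  All roots of an orthogonal polynomial lie strictly inside the interval, so for even \<open>m\<close> the
  numbers \<open>\<pi>\<^sub>m(-1)\<close> and \<open>\<pi>\<^sub>m(1)\<close> are nonzero of equal sign
  (\<open>orthogonal_polys_endpoints_same_sign\<close>) and \<open>\<rho> = \<pi>\<^sub>m(1) / \<pi>\<^sub>m(-1)\<close> is positive. Continuity at
  the vertices says that the value of \<open>f\<close> is multiplied by \<open>\<rho>\<close> along each edge. Going once around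
  the polygon gives \<open>f(v\<^sub>1) = \<rho>\<^sup>N f(v\<^sub>1)\<close>. If \<open>\<rho> \<noteq> 1\<close>, then \<open>\<rho>\<^sup>N \<noteq> 1\<close> by positivity, so \<open>f\<close> vanishes
  at all vertices, every \<open>c\<^sub>i\<close> is zero, and \<open>f = 0\<close> on the boundary. If \<open>\<rho> = 1\<close>, the copies of
  \<open>\<pi>\<^sub>m\<close> on all edges fit together to a continuous function that does not vanish at the vertices
  and on which all degrees of freedom vanish (\<open>exists_repeated_edge_poly\<close>).

  The remaining conditions all restate \<open>\<pi>\<^sub>m(1) \<noteq> \<pi>\<^sub>m(-1)\<close>: by the fundamental theorem of calculus,
  and because the even powers cancel in \<open>\<pi>\<^sub>m(1) - \<pi>\<^sub>m(-1)\<close>.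
\<close>

section \<open>Polynomials orthogonal with respect to a weight\<close>

lemma weight_poly_integrable:
  assumes "weight_function l u w"
  shows "set_integrable lebesgue {l..u} (\<lambda>t. poly p t * w t)"
proof -
  have "(\<lambda>t. indicat_real {l..u} t *\<^sub>R (poly p t * w t))
      = (\<lambda>t. \<Sum>k\<le>degree p. coeff p k * (indicat_real {l..u} t *\<^sub>R (t ^ k * w t)))"
    by (simp add: poly_altdef sum_distrib_left sum_distrib_right mult_ac)
  moreover have "integrable lebesgue
      (\<lambda>t. \<Sum>k\<le>degree p. coeff p k * (indicat_real {l..u} t *\<^sub>R (t ^ k * w t)))"
    using assms unfolding weight_function_def set_integrable_def
    by (intro Bochner_Integration.integrable_sum integrable_mult_right) auto
  ultimately show ?thesis
    unfolding set_integrable_def by simp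
qed

text \<open>The product of the polynomial and the weight vanishes almost everywhere. As a nonzero
  polynomial has finitely many roots, it would force the weight to vanish almost everywhere
  on the interval, against its positive integral.\<close>

lemma weight_nonneg_poly_zero:
  assumes w: "weight_function l u w"
    and nonneg: "\<And>t. t \<in> {l..u} \<Longrightarrow> 0 \<le> poly s t"
    and zero: "(LINT t:{l..u}|lebesgue. poly s t * w t) = 0"
  shows "s = 0"
proof (rule ccontr)
  assume "s \<noteq> 0"
  have "AE t in lebesgue. indicat_real {l..u} t *\<^sub>R (poly s t * w t) = 0"
    using zero weight_poly_integrable[OF w, of s] nonneg w
    unfolding set_integrable_def set_lebesgue_integral_def weight_function_def
    by (subst integral_nonneg_eq_0_iff_AE[symmetric]) (auto simp: indicator_def)
  moreover have "AE t in lebesgue. poly s t \<noteq> 0"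
  proof -
    have "AE t in lborel. poly s t \<noteq> 0"
      using \<open>s \<noteq> 0\<close>
      by (intro AE_I'[OF finite_imp_null_set_lborel[OF poly_roots_finite[of s]]]) auto
    then show ?thesis by (rule AE_completion)
  qed
  ultimately have "AE t in lebesgue. indicat_real {l..u} t *\<^sub>R w t = 0"
    by eventually_elim auto
  then have "(LINT t:{l..u}|lebesgue. w t) = 0"
    unfolding set_lebesgue_integral_def by (rule integral_eq_zero_AE)
  with w show False by (simp add: weight_function_def)
qed

lemma orthogonal_polys_nonzero:
  assumes "orthogonal_polys l u w \<pi>"
  shows "\<pi> n \<noteq> 0"
proof
  assume "\<pi> n = 0"
  then have "(LINT t:{l..u}|lebesgue. poly (\<pi> n) t * poly (\<pi> n) t * w t) = 0"
    by (simp add: set_lebesgue_integral_def)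
  with assms show False
    by (fastforce simp: orthogonal_polys_def)
qed

text \<open>The induction removes the leading term of \<open>q\<close> by a multiple of \<open>\<pi>\<close> of the same degree.\<close>

lemma orthogonal_polys_lower_degree:
  assumes w: "weight_function l u w" and orth: "orthogonal_polys l u w \<pi>"
    and "degree q < n"
  shows "(LINT t:{l..u}|lebesgue. poly (\<pi> n * q) t * w t) = 0"
  using \<open>degree q < n\<close>
proof (induction "degree q" arbitrary: q rule: less_induct)
  case less
  have deg: "degree (\<pi> k) = k" for k
    using orth by (simp add: orthogonal_polys_def)
  have orth_n: "(LINT t:{l..u}|lebesgue. poly (\<pi> n * \<pi> k) t * w t) = 0" if "k < n" for k
    using orth that by (auto simp: orthogonal_polys_def)
  define c where "c = lead_coeff q / lead_coeff (\<pi> (degree q))"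
  define r where "r = q - smult c (\<pi> (degree q))"
  have split: "(LINT t:{l..u}|lebesgue. poly (\<pi> n * q) t * w t)
      = (LINT t:{l..u}|lebesgue. poly (\<pi> n * r) t * w t)
        + c * (LINT t:{l..u}|lebesgue. poly (\<pi> n * \<pi> (degree q)) t * w t)"
  proof -
    have "(LINT t:{l..u}|lebesgue. poly (\<pi> n * q) t * w t)
        = (LINT t:{l..u}|lebesgue. poly (\<pi> n * r) t * w t
            + c * (poly (\<pi> n * \<pi> (degree q)) t * w t))"
      by (rule arg_cong[where f = "set_lebesgue_integral lebesgue {l..u}"])
         (auto simp: r_def algebra_simps)
    then show ?thesis
      using weight_poly_integrable[OF w]
      by (simp only: set_integral_add set_integrable_mult_right set_integral_mult_right)
  qed
  have "degree r \<le> degree q"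
    unfolding r_def by (rule degree_diff_le) (auto simp: deg)
  moreover have "coeff r (degree q) = 0"
    using orthogonal_polys_nonzero[OF orth, of "degree q"]
    by (simp add: r_def c_def deg) (metis deg leading_coeff_0_iff)
  ultimately have "r = 0 \<or> degree r < degree q"
    by (metis leading_coeff_0_iff le_neq_implies_less)
  then have "(LINT t:{l..u}|lebesgue. poly (\<pi> n * r) t * w t) = 0"
    using less.hyps[of r] less.prems by (auto simp: set_lebesgue_integral_def)
  then show ?case
    using split orth_n[OF less.prems] by simp
qed

text \<open>If \<open>\<pi>\<^sub>n = (x - r) q\<close> with \<open>r\<close> outside the open interval, then \<open>\<pi>\<^sub>n q = (x - r) q\<^sup>2\<close> does not
  change sign although its weighted integral vanishes.\<close>

lemma orthogonal_polys_roots_inside: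
  assumes w: "weight_function l u w" and orth: "orthogonal_polys l u w \<pi>"
    and root: "poly (\<pi> n) r = 0"
  shows "l < r \<and> r < u"
proof (rule ccontr)
  assume outside: "\<not> (l < r \<and> r < u)"
  have nz: "\<pi> n \<noteq> 0"
    by (rule orthogonal_polys_nonzero[OF orth])
  obtain q where q: "\<pi> n = [:- r, 1:] * q"
    using root by (auto simp: poly_eq_0_iff_dvd elim: dvdE)
  with nz have "q \<noteq> 0" by auto
  then have "degree (\<pi> n) = Suc (degree q)"
    unfolding q by (subst degree_mult_eq) auto
  moreover have "degree (\<pi> n) = n" using orth by (simp add: orthogonal_polys_def)
  ultimately have int0: "(LINT t:{l..u}|lebesgue. poly (\<pi> n * q) t * w t) = 0"
    by (intro orthogonal_polys_lower_degree[OF w orth]) simp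
  have factored: "\<pi> n * q = [:- r, 1:] * (q * q)" by (simp only: q mult.assoc)
  consider "r \<le> l" | "u \<le> r" using outside by linarith
  then have "\<pi> n * q = 0"
  proof cases
    case 1
    then show ?thesis
      by (intro weight_nonneg_poly_zero[OF w _ int0])
         (simp only: factored poly_mult, auto intro!: mult_nonneg_nonneg)
  next
    case 2
    have "(LINT t:{l..u}|lebesgue. poly (- (\<pi> n * q)) t * w t) = 0"
      using int0 by (simp add: set_lebesgue_integral_def)
    then have "- (\<pi> n * q) = 0"
      using 2 by (intro weight_nonneg_poly_zero[OF w])
        (simp only: factored poly_minus poly_mult neg_0_le_iff_le,
         auto intro!: mult_nonpos_nonneg)
    then show ?thesis by simp
  qed
  with nz \<open>q \<noteq> 0\<close> show False by simp
qed

text \<open>A polynomial without roots in \<open>[u, \<infinity>)\<close> keeps there the sign it has at infinity.\<close>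

lemma poly_sgn_beyond_roots:
  fixes p :: "real poly"
  assumes "\<And>x. u \<le> x \<Longrightarrow> poly p x \<noteq> 0"
  shows "sgn (poly p u) = sgn (lead_coeff p)"
proof -
  have pos: "0 < poly q u" if lc: "0 < lead_coeff q" and nr: "\<And>x. u \<le> x \<Longrightarrow> poly q x \<noteq> 0"
    for q :: "real poly"
  proof (rule ccontr)
    assume "\<not> 0 < poly q u"
    then have neg: "poly q u < 0" using nr[of u] by simp
    obtain n where n: "\<forall>x\<ge>n. lead_coeff q \<le> poly q x"
      using poly_pinfty_gt_lc[OF lc] by blast
    define x where "x = max (u + 1) n"
    have "0 < poly q x" using n lc by (auto simp: x_def intro: less_le_trans)
    moreover have "u < x" by (simp add: x_def less_max_iff_disj)
    ultimately obtain y where "u < y" "poly q y = 0"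
      using poly_IVT_pos[of u x q] neg by auto
    then show False using nr[of y] by simp
  qed
  have "p \<noteq> 0" using assms[of u] by auto
  then have "0 < lead_coeff p \<or> 0 < lead_coeff (- p)" by (auto simp: less_le)
  then show ?thesis
    using pos[of p] pos[of "- p"] assms by (auto simp: sgn_if)
qed

text \<open>For even \<open>n\<close> the polynomial has the same sign at \<open>\<infinity>\<close> and at \<open>-\<infinity>\<close>, and no root separates
  the interval from either of them.\<close>

lemma orthogonal_polys_endpoints_same_sign:
  assumes w: "weight_function l u w" and orth: "orthogonal_polys l u w \<pi>"
    and "even n"
  shows "0 < poly (\<pi> n) l * poly (\<pi> n) u"
proof -
  have deg: "degree (\<pi> n) = n" using orth by (simp add: orthogonal_polys_def)
  \<comment> \<open>The reflected polynomial turns the behaviour at \<open>-\<infinity>\<close> into that at \<open>\<infinity>\<close>.\<close>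
  define \<pi>' where "\<pi>' = pcompose (\<pi> n) [:0, - 1:]"
  have *: "poly (\<pi> n) x \<noteq> 0" if "x \<le> l \<or> u \<le> x" for x
    using orthogonal_polys_roots_inside[OF w orth, of n x] that by auto
  have "sgn (poly (\<pi> n) u) = sgn (lead_coeff (\<pi> n))"
    by (rule poly_sgn_beyond_roots) (use * in auto)
  moreover have "sgn (poly \<pi>' (- l)) = sgn (lead_coeff \<pi>')"
    by (rule poly_sgn_beyond_roots) (use * in \<open>auto simp: \<pi>'_def poly_pcompose\<close>)
  moreover have "lead_coeff \<pi>' = lead_coeff (\<pi> n)"
    using \<open>even n\<close> by (simp add: \<pi>'_def lead_coeff_comp deg)
  moreover have "poly (\<pi> n) u \<noteq> 0" using *[of u] by simp
  ultimately show ?thesis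
    by (auto simp: \<pi>'_def poly_pcompose sgn_if zero_less_mult_iff split: if_splits)
qed

text \<open>Subtracting the multiple of \<open>\<pi>\<^sub>n\<close> with the same coefficient at \<open>n\<close> leaves a \<open>q\<close> of lower
  degree that is orthogonal to all lower degrees, hence to itself.\<close>

lemma orthogonal_to_lower_degree_imp_multiple:
  assumes w: "weight_function l u w" and orth: "orthogonal_polys l u w \<pi>"
    and "1 \<le> n" "degree p \<le> n"
    and p: "\<And>q. degree q < n \<Longrightarrow> (LINT t:{l..u}|lebesgue. poly (p * q) t * w t) = 0"
  shows "\<exists>c. p = smult c (\<pi> n)"
proof -
  have deg: "degree (\<pi> n) = n" using orth by (simp add: orthogonal_polys_def)
  then have lc: "coeff (\<pi> n) n \<noteq> 0" using \<open>1 \<le> n\<close> by (metis degree_0 leading_coeff_0_iff not_one_le_zero)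
  define c where "c = coeff p n / coeff (\<pi> n) n"
  define q where "q = p - smult c (\<pi> n)"
  have "degree q \<le> n" unfolding q_def by (rule degree_diff_le) (use \<open>degree p \<le> n\<close> deg in auto)
  moreover have "coeff q n = 0" using lc by (simp add: q_def c_def)
  ultimately have dq: "degree q < n"
    using \<open>1 \<le> n\<close> by (metis degree_0 leading_coeff_0_iff le_neq_implies_less less_le_trans zero_less_one)
  have "(LINT t:{l..u}|lebesgue. poly (q * q) t * w t)
      = (LINT t:{l..u}|lebesgue. poly (p * q) t * w t - c * (poly (\<pi> n * q) t * w t))"
    by (rule arg_cong[where f = "set_lebesgue_integral lebesgue {l..u}"])
       (auto simp: q_def algebra_simps)
  also have "\<dots> = (LINT t:{l..u}|lebesgue. poly (p * q) t * w t)
      - c * (LINT t:{l..u}|lebesgue. poly (\<pi> n * q) t * w t)"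
    using weight_poly_integrable[OF w]
    by (simp only: set_integral_diff set_integrable_mult_right set_integral_mult_right)
  also have "\<dots> = 0"
    using p[OF dq] orthogonal_polys_lower_degree[OF w orth dq] by simp
  finally have "q * q = 0"
    by (intro weight_nonneg_poly_zero[OF w]) auto
  then show ?thesis by (auto simp: q_def)
qed

lemma weight_poly_integral_sum:
  assumes w: "weight_function l u w"
  shows "(LINT t:{l..u}|lebesgue. poly (\<Sum>j\<in>J. smult (c j) (P j)) t * w t)
    = (\<Sum>j\<in>J. c j * (LINT t:{l..u}|lebesgue. poly (P j) t * w t))"
proof -
  have "(LINT t:{l..u}|lebesgue. poly (\<Sum>j\<in>J. smult (c j) (P j)) t * w t)
      = (LINT t|lebesgue. (\<Sum>j\<in>J. c j * (indicat_real {l..u} t *\<^sub>R (poly (P j) t * w t))))"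
    unfolding set_lebesgue_integral_def
    by (rule Bochner_Integration.integral_cong)
       (auto simp: poly_sum sum_distrib_left sum_distrib_right mult_ac)
  also have "\<dots> = (\<Sum>j\<in>J. c j * (LINT t:{l..u}|lebesgue. poly (P j) t * w t))"
    using weight_poly_integrable[OF w]
    unfolding set_lebesgue_integral_def set_integrable_def
    by (subst Bochner_Integration.integral_sum) auto
  finally show ?thesis .
qed

section \<open>Almost everywhere equality on an interval\<close>

text \<open>No measurability of \<open>f\<close> is required, because Lebesgue measure is complete.\<close>

lemma set_lebesgue_integral_cong_AE_lborel:
  fixes f g :: "real \<Rightarrow> real"
  assumes g: "set_integrable lebesgue {l..u} g"
    and ae: "AE t in lborel. t \<in> {l..u} \<longrightarrow> f t = g t"
  shows "(LINT t:{l..u}|lebesgue. f t) = (LINT t:{l..u}|lebesgue. g t)"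
proof -
  let ?F = "\<lambda>t. indicat_real {l..u} t *\<^sub>R f t" and ?G = "\<lambda>t. indicat_real {l..u} t *\<^sub>R g t"
  have G: "?G \<in> borel_measurable lebesgue"
    using g unfolding set_integrable_def by (rule borel_measurable_integrable)
  have eq: "AE t in lebesgue. ?G t = ?F t"
    using AE_completion[OF ae] by eventually_elim (auto simp: indicator_def)
  have "?F \<in> borel_measurable lebesgue"
  proof (rule measurableI)
    fix A :: "real set" assume "A \<in> sets borel"
    have "AE t in lebesgue. t \<in> ?G -` A \<inter> space lebesgue \<longleftrightarrow> t \<in> ?F -` A \<inter> space lebesgue"
      using eq by eventually_elim auto
    moreover have "?G -` A \<inter> space lebesgue \<in> sets lebesgue"
      using G \<open>A \<in> sets borel\<close> by (rule measurable_sets)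
    ultimately show "?F -` A \<inter> space lebesgue \<in> sets lebesgue"
      by (rule completion.in_sets_AE) simp
  qed auto
  then show ?thesis
    unfolding set_lebesgue_integral_def using G eq by (intro integral_cong_AE) auto
qed

lemma continuous_AE_eq_imp_eq:
  fixes f g :: "real \<Rightarrow> real"
  assumes "l < u" "continuous_on {l..u} f" "continuous_on {l..u} g"
    and ae: "AE s in lborel. s \<in> {l..u} \<longrightarrow> f s = g s"
    and "s \<in> {l..u}"
  shows "f s = g s"
proof -
  have "((\<lambda>s. \<bar>f s - g s\<bar>) has_integral 0) {l..u} \<longleftrightarrow> ((\<lambda>s. 0) has_integral (0::real)) {l..u}"
    by (rule has_integral_AE) (use ae in \<open>eventually_elim, auto\<close>)
  then have "integral {l..u} (\<lambda>s. \<bar>f s - g s\<bar>) = 0"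
    by (intro integral_unique) simp
  then show ?thesis
    using assms by (subst (asm) integral_eq_0_iff) (auto intro!: continuous_intros)
qed

section \<open>Degrees of freedom on the reference interval\<close>

text \<open>The function \<open>f\<close> on edge \<open>i\<close>, in the affine parameter \<open>s\<close> that runs from \<open>-1\<close> at \<open>v i\<close> to \<open>1\<close> at
  \<open>v (Suc i)\<close>. Values outside \<open>[-1, 1]\<close> carry no meaning.\<close>

definition edge_pullback ::
    "(nat \<Rightarrow> real^2) \<Rightarrow> nat \<Rightarrow> (real^2 \<Rightarrow> real) \<Rightarrow> real \<Rightarrow> real" where
  "edge_pullback v i f s = f (linepath (v i) (v (Suc i)) ((s + 1) / 2))"

lemma edge_trace_eq_pullback:
  assumes "a < b"
  shows "edge_trace a b v i f x = edge_pullback v i f (rescale a b x)"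
proof -
  have "(rescale a b x + 1) / 2 = (x - a) / (b - a)" "1 - (x - a) / (b - a) = (b - x) / (b - a)"
    using assms by (auto simp: rescale_def field_simps)
  then show ?thesis
    by (simp only: edge_trace_def edge_param_def edge_pullback_def linepath_def)
qed

text \<open>The substitution formula needs no integrability: if one side is not integrable, neither is the
  other, and both integrals are \<open>0\<close> by convention.\<close>

lemma set_integral_rescale:
  fixes F :: "real \<Rightarrow> real"
  assumes "a < b"
  shows "(LINT x:{a..b}|lebesgue. F (rescale a b x)) = (b - a) / 2 * (LINT s:{-1..1}|lebesgue. F s)"
proof -
  \<comment> \<open>Half length and midpoint of \<open>[a, b]\<close>: \<open>s \<mapsto> t + c s\<close> inverts the rescaling map.\<close>
  define c t where "c = (b - a) / 2" and "t = (a + b) / 2"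
  have ab: "a = t - c" "b = t + c" by (simp_all add: c_def t_def field_simps)
  have "0 < c" using assms by (simp add: c_def)
  have "(a + b - 2 * (t + c * s)) = s * (a - b)" for s by (simp add: ab algebra_simps)
  then have r: "rescale a b (t + c * s) = s" for s
    using assms by (simp add: rescale_def)
  have "a \<le> t + c * s \<longleftrightarrow> c * (- 1) \<le> c * s" "t + c * s \<le> b \<longleftrightarrow> c * s \<le> c * 1" for s
    by (auto simp: ab)
  then have ind: "indicat_real {a..b} (t + c * s) = indicat_real {-1..1} s" for s
    using \<open>0 < c\<close> by (simp only: indicator_def atLeastAtMost_iff mult_le_cancel_left_pos)
  have "(LINT x:{a..b}|lebesgue. F (rescale a b x))
      = \<bar>c\<bar> *\<^sub>R (LINT s|lebesgue. indicat_real {a..b} (t + c * s) *\<^sub>R F (rescale a b (t + c * s)))"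
    unfolding set_lebesgue_integral_def
    by (rule lebesgue_integral_real_affine) (use \<open>0 < c\<close> in simp)
  also have "\<dots> = c * (LINT s:{-1..1}|lebesgue. F s)"
    unfolding r ind set_lebesgue_integral_def using \<open>0 < c\<close> by simp
  finally show ?thesis by (simp only: c_def)
qed

text \<open>The substitution \<open>t = (s + 1) / 2\<close> pulls null sets back to null sets.\<close>

lemma AE_unit_interval_imp_AE_reference:
  assumes "AE t in lborel. t \<in> {0..1} \<longrightarrow> P t"
  shows "AE s in lborel. s \<in> {-1..1} \<longrightarrow> P ((s + 1) / 2 :: real)"
proof -
  have "lborel = density (distr lborel borel (\<lambda>x. 1/2 + 1/2 * x :: real)) (\<lambda>_. ennreal (abs (1/2 :: real)))"
    by (rule lborel_real_affine) simp
  with assms have "AE t in density (distr lborel borel (\<lambda>x. 1/2 + 1/2 * x :: real)) (\<lambda>_. ennreal (abs (1/2 :: real))).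
      t \<in> {0..1} \<longrightarrow> P t" by metis
  then have "AE t in distr lborel borel (\<lambda>x. 1/2 + 1/2 * x :: real). t \<in> {0..1} \<longrightarrow> P t"
    by (subst (asm) AE_density) auto
  then have "AE s in lborel. 1/2 + 1/2 * s \<in> {0..1} \<longrightarrow> P (1/2 + 1/2 * s)"
    by (rule AE_distrD[rotated]) auto
  then show ?thesis
    by eventually_elim (auto simp: add_divide_distrib add.commute)
qed

lemma dof_of_poly_pullbacks:
  assumes "a < b" and w: "weight_function (-1) 1 w"
    and f: "\<And>i. i \<in> {1..N} \<Longrightarrow> AE s in lborel. s \<in> {-1..1} \<longrightarrow> edge_pullback v i f s = poly (F i) s"
    and g: "\<And>i. i \<in> {1..N} \<Longrightarrow> AE s in lborel. s \<in> {-1..1} \<longrightarrow> edge_pullback v i g s = poly (G i) s"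
  shows "dof N v a b (w \<circ> rescale a b) g f
    = (b - a) / 2 * (\<Sum>i=1..N. LINT s:{-1..1}|lebesgue. poly (F i * G i) s * w s)"
proof -
  have "dof N v a b (w \<circ> rescale a b) g f
      = (\<Sum>i=1..N. (b - a) / 2 *
          (LINT s:{-1..1}|lebesgue. edge_pullback v i f s * edge_pullback v i g s * w s))"
    unfolding dof_def
    by (simp only: edge_trace_eq_pullback[OF assms(1)] o_def
        set_integral_rescale[OF assms(1), symmetric])
  also have "\<dots> = (\<Sum>i=1..N. (b - a) / 2 * (LINT s:{-1..1}|lebesgue. poly (F i * G i) s * w s))"
  proof (intro sum.cong refl arg_cong2[where f = "(*)"])
    fix i assume i: "i \<in> {1..N}"
    have "AE s in lborel. s \<in> {-1..1} \<longrightarrow>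
        edge_pullback v i f s * edge_pullback v i g s * w s = poly (F i * G i) s * w s"
      using f[OF i] g[OF i] by eventually_elim auto
    then show "(LINT s:{-1..1}|lebesgue. edge_pullback v i f s * edge_pullback v i g s * w s)
        = (LINT s:{-1..1}|lebesgue. poly (F i * G i) s * w s)"
      by (rule set_lebesgue_integral_cong_AE_lborel[OF weight_poly_integrable[OF w]])
  qed
  finally show ?thesis by (simp add: sum_distrib_left)
qed

section \<open>Arc length on the boundary of a polygon\<close>

lemma polygon_frontier: "polygon N v K \<Longrightarrow> frontier K = (\<Union>i\<in>{1..N}. edge v i)"
  by (simp add: polygon_def)

lemma polygon_edge_nondegenerate:
  assumes "polygon N v K" "i \<in> {1..N}"
  shows "v i \<noteq> v (Suc i)"
proof
  assume eq: "v i = v (Suc i)"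
  have inj: "inj_on v {1..N}" and "3 \<le> N" "v (Suc N) = v 1"
    using assms by (auto simp: polygon_def)
  show False
  proof (cases "i = N")
    case True
    then have "N = 1" using inj_onD[OF inj, of N 1] eq \<open>v (Suc N) = v 1\<close> \<open>3 \<le> N\<close> by auto
    then show False using \<open>3 \<le> N\<close> by simp
  next
    case False
    then show False using inj_onD[OF inj, of i "Suc i"] eq assms by auto
  qed
qed

lemma linepath_in_edge: "t \<in> {0..1} \<Longrightarrow> linepath (v i) (v (Suc i)) t \<in> edge v i"
  unfolding edge_def by (rule linepath_in_path)

lemma linepath_in_frontier:
  "polygon N v K \<Longrightarrow> i \<in> {1..N} \<Longrightarrow> t \<in> {0..1} \<Longrightarrow> linepath (v i) (v (Suc i)) t \<in> frontier K"
  using linepath_in_edge by (fastforce simp: polygon_frontier)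

lemma boundary_param_measurable:
  assumes "polygon N v K"
  shows "(\<lambda>(i, t). linepath (v i) (v (Suc i)) t)
    \<in> density (count_space {1..N} \<Otimes>\<^sub>M restrict_space lborel {0..1})
          (\<lambda>(i, t). ennreal (dist (v i) (v (Suc i))))
      \<rightarrow>\<^sub>M restrict_space borel (frontier K)"
proof -
  have "(\<lambda>(i, t). linepath (v i) (v (Suc i)) t)
    \<in> count_space {1..N} \<Otimes>\<^sub>M restrict_space lborel {0..1} \<rightarrow>\<^sub>M restrict_space borel (frontier K)"
  proof (rule measurable_pair_measure_countable1)
    fix i assume "i \<in> {1..N}"
    then show "(\<lambda>t. case (i, t) of (i, t) \<Rightarrow> linepath (v i) (v (Suc i)) t)
        \<in> restrict_space lborel {0..1} \<rightarrow>\<^sub>M restrict_space borel (frontier K)"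
      using linepath_in_frontier[OF assms]
      by (intro measurable_restrict_space2)
         (auto simp: space_restrict_space linepath_def[abs_def] intro!: measurable_restrict_space1)
  qed auto
  then show ?thesis by simp
qed

lemma edge_length_measurable:
  "(\<lambda>(i, t). ennreal (dist (v i) (v (Suc i))))
    \<in> borel_measurable (count_space {1..N::nat} \<Otimes>\<^sub>M restrict_space lborel {0..1::real})"
  by (rule measurable_pair_measure_countable1) auto

text \<open>A property that holds almost everywhere with respect to arc length holds almost everywhere along
  each edge: every edge has positive length, so its share of the measure is not lost.\<close>

lemma AE_boundary_imp_AE_pullback:
  assumes poly: "polygon N v K" and i: "i \<in> {1..N}"
    and ae: "AE x in boundary_measure N v K. P x"
  shows "AE s in lborel. s \<in> {-1..1} \<longrightarrow> P (linepath (v i) (v (Suc i)) ((s + 1) / 2))"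
proof -
  let ?M = "restrict_space lborel {0..1::real}"
  have "sigma_finite_measure ?M"
    by (intro finite_measure.axioms(1) finite_measureI)
       (simp add: emeasure_restrict_space space_restrict_space)
  then interpret pair_sigma_finite "count_space {1..N}" ?M
    by (simp add: pair_sigma_finite_def sigma_finite_measure_count_space_finite)
  have "AE y in density (count_space {1..N} \<Otimes>\<^sub>M ?M) (\<lambda>(i, t). ennreal (dist (v i) (v (Suc i)))).
      P (case y of (i, t) \<Rightarrow> linepath (v i) (v (Suc i)) t)"
    using ae unfolding boundary_measure_def by (rule AE_distrD[OF boundary_param_measurable[OF poly]])
  then have "AE y in count_space {1..N} \<Otimes>\<^sub>M ?M.
      0 < (case y of (i, t) \<Rightarrow> ennreal (dist (v i) (v (Suc i)))) \<longrightarrow>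
      P (case y of (i, t) \<Rightarrow> linepath (v i) (v (Suc i)) t)"
    by (subst (asm) AE_density[OF edge_length_measurable])
  then have "AE j in count_space {1..N}. AE t in ?M. 0 < ennreal (dist (v j) (v (Suc j))) \<longrightarrow>
      P (linepath (v j) (v (Suc j)) t)"
    by (drule_tac AE_pair) simp
  then have "AE t in ?M. P (linepath (v i) (v (Suc i)) t)"
    using i polygon_edge_nondegenerate[OF poly i] by (auto simp: AE_count_space)
  then have "AE t in lborel. t \<in> {0..1} \<longrightarrow> P (linepath (v i) (v (Suc i)) t)"
    by (subst (asm) AE_restrict_space_iff) auto
  then show ?thesis by (rule AE_unit_interval_imp_AE_reference)
qed

lemma finite_boundary_measure:
  assumes "polygon N v K"
  shows "finite_measure (boundary_measure N v K)"
proof -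
  let ?M = "count_space {1..N} \<Otimes>\<^sub>M restrict_space lborel {0..1::real}"
  let ?f = "\<lambda>(i, t). ennreal (dist (v i) (v (Suc i)))"
  let ?C = "ennreal (\<Sum>i=1..N. dist (v i) (v (Suc i)))"
  have "finite_measure (restrict_space lborel {0..1::real})"
    by (intro finite_measureI) (simp add: emeasure_restrict_space space_restrict_space)
  then interpret finite_measure ?M
    by (intro finite_measure_pair_measure finite_measure_count_space) auto
  have "emeasure (density ?M ?f) (space ?M) = (\<integral>\<^sup>+y. ?f y * indicator (space ?M) y \<partial>?M)"
    by (rule emeasure_density[OF edge_length_measurable sets.top])
  also have "\<dots> \<le> (\<integral>\<^sup>+y. ?C \<partial>?M)"
    by (rule nn_integral_mono)
       (auto simp: space_pair_measure indicator_def intro!: ennreal_leI member_le_sum)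
  also have "\<dots> < \<infinity>"
    using emeasure_finite by (simp add: ennreal_mult_less_top less_top)
  finally have "emeasure (density ?M ?f) (space (density ?M ?f)) \<noteq> \<infinity>"
    by simp
  then have "finite_measure (density ?M ?f)" by (rule finite_measureI)
  then show ?thesis
    unfolding boundary_measure_def
    by (rule finite_measure.finite_measure_distr) (rule boundary_param_measurable[OF assms])
qed

lemma bounded_borel_in_boundary_L2:
  assumes "polygon N v K"
    and f: "f \<in> borel_measurable (restrict_space borel (frontier K))"
    and bound: "\<And>x. x \<in> frontier K \<Longrightarrow> \<bar>f x\<bar> \<le> B"
  shows "f \<in> boundary_L2 N v K"
proof -
  interpret finite_measure "boundary_measure N v K" by (rule finite_boundary_measure[OF assms(1)])
  have meas: "f \<in> borel_measurable (boundary_measure N v K)"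
    using f by (simp add: boundary_measure_def)
  have space: "space (boundary_measure N v K) = frontier K"
    by (simp add: boundary_measure_def space_restrict_space)
  have "integrable (boundary_measure N v K) (\<lambda>x. (f x)\<^sup>2)"
  proof (rule integrable_const_bound)
    show "AE x in boundary_measure N v K. norm ((f x)\<^sup>2) \<le> B\<^sup>2"
    proof (rule AE_I2)
      fix x assume "x \<in> space (boundary_measure N v K)"
      then have "\<bar>f x\<bar> \<le> B" using bound space by simp
      then have "\<bar>f x\<bar>\<^sup>2 \<le> B\<^sup>2" by (intro power_mono) auto
      then show "norm ((f x)\<^sup>2) \<le> B\<^sup>2" by simp
    qed
  qed (use meas in measurable)
  with meas show ?thesis by (simp add: boundary_L2_def)
qed

section \<open>Piecewise polynomials on the boundary\<close>

lemma piecewise_poly_pullback: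
  assumes "f \<in> piecewise_poly d N v K" "i \<in> {1..N}"
  shows "\<exists>p. degree p \<le> d \<and> (AE s in lborel. s \<in> {-1..1} \<longrightarrow> edge_pullback v i f s = poly p s)"
proof -
  obtain p where p: "degree p \<le> d"
      "AE t in lborel. t \<in> {0..1} \<longrightarrow> f (linepath (v i) (v (Suc i)) t) = poly p t"
    using assms unfolding piecewise_poly_def by blast
  let ?q = "pcompose p [:1/2, 1/2:]"
  have "degree ?q \<le> d" using p(1) by (simp add: degree_pcompose)
  moreover have "AE s in lborel. s \<in> {-1..1} \<longrightarrow> edge_pullback v i f s = poly ?q s"
    using AE_unit_interval_imp_AE_reference[OF p(2)]
    by eventually_elim (auto simp: edge_pullback_def poly_pcompose field_simps)
  ultimately show ?thesis by blast
qed

text \<open>For continuous functions the identification with a polynomial is exact, also at the vertices.\<close>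

lemma piecewise_poly_cont_pullback:
  assumes poly: "polygon N v K" and f: "f \<in> piecewise_poly_cont d N v K" and i: "i \<in> {1..N}"
  shows "\<exists>p. degree p \<le> d \<and> (\<forall>s\<in>{-1..1}. edge_pullback v i f s = poly p s)"
proof -
  obtain p where p: "degree p \<le> d"
      "AE s in lborel. s \<in> {-1..1} \<longrightarrow> edge_pullback v i f s = poly p s"
    using piecewise_poly_pullback[of f d N v K i] f i by (auto simp: piecewise_poly_cont_def)
  have "continuous_on {-1..1} (\<lambda>s. f (linepath (v i) (v (Suc i)) ((s + 1) / 2)))"
  proof (rule continuous_on_compose2[of "frontier K" f])
    show "continuous_on (frontier K) f" using f by (simp add: piecewise_poly_cont_def)
    show "continuous_on {-1..1} (\<lambda>s. linepath (v i) (v (Suc i)) ((s + 1) / 2))"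
      unfolding linepath_def by (intro continuous_intros) auto
    show "(\<lambda>s. linepath (v i) (v (Suc i)) ((s + 1) / 2)) ` {-1..1} \<subseteq> frontier K"
      using linepath_in_frontier[OF poly i] by auto
  qed
  then have "continuous_on {-1..1} (edge_pullback v i f)"
    by (simp add: edge_pullback_def[abs_def])
  then have "edge_pullback v i f s = poly p s" if "s \<in> {-1..1}" for s
    by (rule continuous_AE_eq_imp_eq[where g = "poly p", rotated])
       (use p(2) that in \<open>auto intro: continuous_on_poly continuous_on_id\<close>)
  with p(1) show ?thesis by blast
qed

text \<open>The reference parameter of the orthogonal projection of a point to the line through edge \<open>i\<close>;
  it is defined on the whole plane and, for distinct end points, inverts the parametrisation of the
  edge by \<open>[-1, 1]\<close>.\<close>

definition edge_coord :: "(nat \<Rightarrow> real^2) \<Rightarrow> nat \<Rightarrow> real^2 \<Rightarrow> real" where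
  "edge_coord v i x =
     2 * ((x - v i) \<bullet> (v (Suc i) - v i)) / ((v (Suc i) - v i) \<bullet> (v (Suc i) - v i)) - 1"

lemma edge_coord_linepath:
  assumes "v i \<noteq> v (Suc i)"
  shows "edge_coord v i (linepath (v i) (v (Suc i)) t) = 2 * t - 1"
proof -
  have "linepath (v i) (v (Suc i)) t - v i = t *\<^sub>R (v (Suc i) - v i)"
    by (simp add: linepath_def algebra_simps)
  then show ?thesis using assms by (simp add: edge_coord_def)
qed

lemma edge_coord_vertices:
  assumes "v i \<noteq> v (Suc i)"
  shows "edge_coord v i (v i) = - 1" "edge_coord v i (v (Suc i)) = 1"
  using edge_coord_linepath[OF assms, of 0] edge_coord_linepath[OF assms, of 1]
  by (simp_all add: linepath_def)

lemma continuous_on_edge_coord: "continuous_on S (edge_coord v i)"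
  unfolding edge_coord_def[abs_def] divide_inverse
  by (intro continuous_on_diff continuous_on_mult continuous_on_inner continuous_on_const
      continuous_on_id)

text \<open>Without continuity at the vertices, a polynomial can be prescribed on one edge and extended by
  zero. The vertices, where the neighbouring edges see the wrong value, are negligible.\<close>

lemma exists_single_edge_poly:
  assumes poly: "polygon N v K" and i: "i \<in> {1..N}" and "degree q \<le> d"
  shows "\<exists>g\<in>piecewise_poly d N v K. (\<forall>s\<in>{-1..1}. edge_pullback v i g s = poly q s) \<and>
    (\<forall>j\<in>{1..N} - {i}. AE s in lborel. s \<in> {-1..1} \<longrightarrow> edge_pullback v j g s = 0)"
proof -
  define g where "g x = (if x \<in> edge v i then poly q (edge_coord v i x) else 0)" for x
  have cont: "continuous_on S (\<lambda>x. poly q (edge_coord v i x))" for S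
    by (intro continuous_on_poly continuous_on_edge_coord)
  have on_i: "g (linepath (v i) (v (Suc i)) t) = poly q (2 * t - 1)" if "t \<in> {0..1}" for t
    using linepath_in_edge[OF that, of v i] polygon_edge_nondegenerate[OF poly i]
    by (simp add: g_def edge_coord_linepath)
  have off_i: "AE t in lborel. t \<in> {0..1} \<longrightarrow> g (linepath (v j) (v (Suc j)) t) = 0"
    if j: "j \<in> {1..N}" "j \<noteq> i" for j
  proof -
    have "t = 0 \<or> t = 1" if t: "t \<in> {0..1}" and "linepath (v j) (v (Suc j)) t \<in> edge v i" for t
    proof -
      let ?x = "linepath (v j) (v (Suc j)) t"
      have nd: "v j \<noteq> v (Suc j)" by (rule polygon_edge_nondegenerate[OF poly j(1)])
      have "edge v j \<inter> edge v i = {v j, v (Suc j)} \<inter> {v i, v (Suc i)}"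
        using poly i j unfolding polygon_def by blast
      then have "?x = v j \<or> ?x = v (Suc j)"
        using linepath_in_edge[OF t, of v j] that(2) by auto
      then have "edge_coord v j ?x = -1 \<or> edge_coord v j ?x = 1"
        using edge_coord_vertices[OF nd] by auto
      then show ?thesis unfolding edge_coord_linepath[OF nd] by auto
    qed
    then have *: "g (linepath (v j) (v (Suc j)) t) = 0" if "t \<in> {0..1}" "t \<noteq> 0" "t \<noteq> 1" for t
      using that by (auto simp: g_def)
    show ?thesis
      using AE_lborel_singleton[of 0] AE_lborel_singleton[of 1] by eventually_elim (use * in auto)
  qed
  have "compact K" using poly by (simp add: polygon_def)
  then have "compact (frontier K)" by (rule compact_frontier)
  then have "bounded ((\<lambda>x. poly q (edge_coord v i x)) ` frontier K)"
    by (intro compact_imp_bounded compact_continuous_image cont)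
  then obtain B where B: "\<And>x. x \<in> frontier K \<Longrightarrow> \<bar>poly q (edge_coord v i x)\<bar> \<le> B"
    unfolding bounded_iff by auto
  have "g \<in> boundary_L2 N v K"
  proof (rule bounded_borel_in_boundary_L2[OF poly])
    have "(\<lambda>x. poly q (edge_coord v i x)) \<in> borel_measurable borel"
      by (rule borel_measurable_continuous_onI) (rule cont)
    moreover have "edge v i \<in> sets borel"
      by (simp add: edge_def borel_closed)
    ultimately have "g \<in> borel_measurable borel"
      unfolding g_def[abs_def] by measurable
    then show "g \<in> borel_measurable (restrict_space borel (frontier K))"
      by (rule measurable_restrict_space1)
    show "\<bar>g x\<bar> \<le> \<bar>B\<bar>" if "x \<in> frontier K" for x
      using B[OF that] by (auto simp: g_def)
  qed
  moreover have "\<exists>p :: real poly. degree p \<le> d \<and>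
      (AE t in lborel. t \<in> {0..1} \<longrightarrow> g (linepath (v j) (v (Suc j)) t) = poly p t)"
    if "j \<in> {1..N}" for j
  proof (cases "j = i")
    case True
    then show ?thesis
      using on_i \<open>degree q \<le> d\<close>
      by (intro exI[of _ "pcompose q [:-1, 2:]"]) (simp add: degree_pcompose poly_pcompose mult.commute)
  next
    case False
    then show ?thesis
      using off_i[OF that] by (intro exI[of _ 0]) simp
  qed
  ultimately have "g \<in> piecewise_poly d N v K"
    unfolding piecewise_poly_def by blast
  moreover have "edge_pullback v i g s = poly q s" if "s \<in> {-1..1}" for s
    using on_i[of "(s + 1) / 2"] that by (simp add: edge_pullback_def add_divide_distrib)
  moreover have "AE s in lborel. s \<in> {-1..1} \<longrightarrow> edge_pullback v j g s = 0"
    if "j \<in> {1..N} - {i}" for j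
    using AE_unit_interval_imp_AE_reference[OF off_i[of j]] that
    by (simp add: edge_pullback_def)
  ultimately show ?thesis by blast
qed

text \<open>A polynomial with equal values at \<open>-1\<close> and \<open>1\<close> can be repeated on every edge: all vertices
  receive the same value, so the pieces agree wherever two edges meet.\<close>

lemma exists_repeated_edge_poly:
  assumes poly: "polygon N v K" and "degree q \<le> d" and periodic: "poly q (- 1) = poly q 1"
  shows "\<exists>f\<in>piecewise_poly_cont d N v K. \<forall>i\<in>{1..N}. \<forall>s\<in>{-1..1}. edge_pullback v i f s = poly q s"
proof -
  \<comment> \<open>At a shared vertex the edge of least index is used; by \<open>ends\<close> below the choice is irrelevant.\<close>
  define first where "first x = (LEAST i. 1 \<le> i \<and> x \<in> edge v i)" for x
  define f where "f x = poly q (edge_coord v (first x) x)" for x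
  have ends: "poly q (edge_coord v i x) = poly q 1"
    if "i \<in> {1..N}" "x \<in> {v i, v (Suc i)}" for i x
    using edge_coord_vertices[OF polygon_edge_nondegenerate[OF poly that(1)]] that(2) periodic
    by auto
  have f_eq: "f x = poly q (edge_coord v i x)" if i: "i \<in> {1..N}" and x: "x \<in> edge v i" for i x
  proof (cases "first x = i")
    case True
    then show ?thesis by (simp add: f_def)
  next
    case False
    have "1 \<le> first x \<and> x \<in> edge v (first x)"
      unfolding first_def by (rule LeastI[of _ i]) (use i x in auto)
    moreover have "first x \<le> i"
      unfolding first_def by (rule Least_le) (use i x in auto)
    ultimately have k: "first x \<in> {1..N}" "x \<in> edge v (first x)" using i by auto
    then have "x \<in> {v i, v (Suc i)} \<inter> {v (first x), v (Suc (first x))}"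
      using poly i x False unfolding polygon_def by blast
    then show ?thesis
      using ends[OF i, of x] ends[OF k(1), of x] by (simp add: f_def)
  qed
  have on_edge: "f (linepath (v i) (v (Suc i)) t) = poly q (2 * t - 1)"
    if "i \<in> {1..N}" "t \<in> {0..1}" for i t
    using f_eq[OF that(1) linepath_in_edge[OF that(2)]] polygon_edge_nondegenerate[OF poly that(1)]
    by (simp add: edge_coord_linepath)
  have cont: "continuous_on (frontier K) f"
    unfolding polygon_frontier[OF poly]
  proof (rule continuous_on_closed_Union)
    fix i assume i: "i \<in> {1..N}"
    show "closed (edge v i)" by (simp add: edge_def)
    have "continuous_on (edge v i) (\<lambda>x. poly q (edge_coord v i x))"
      by (intro continuous_on_poly continuous_on_edge_coord)
    then show "continuous_on (edge v i) f"
      by (rule continuous_on_eq) (simp add: f_eq[OF i])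
  qed simp
  have "compact K" using poly by (simp add: polygon_def)
  then have "compact (frontier K)" by (rule compact_frontier)
  then have "bounded (f ` frontier K)"
    by (intro compact_imp_bounded compact_continuous_image cont)
  then obtain B where "\<And>x. x \<in> frontier K \<Longrightarrow> \<bar>f x\<bar> \<le> B"
    unfolding bounded_iff by auto
  then have "f \<in> boundary_L2 N v K"
    by (intro bounded_borel_in_boundary_L2[OF poly] borel_measurable_continuous_on_restrict cont)
  moreover have "\<exists>p :: real poly. degree p \<le> d \<and>
      (AE t in lborel. t \<in> {0..1} \<longrightarrow> f (linepath (v i) (v (Suc i)) t) = poly p t)"
    if "i \<in> {1..N}" for i
    using on_edge[OF that] \<open>degree q \<le> d\<close>
    by (intro exI[of _ "pcompose q [:-1, 2:]"]) (simp add: degree_pcompose poly_pcompose mult.commute)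
  ultimately have "f \<in> piecewise_poly_cont d N v K"
    using cont unfolding piecewise_poly_cont_def piecewise_poly_def by blast
  moreover have "edge_pullback v i f s = poly q s" if "i \<in> {1..N}" "s \<in> {-1..1}" for i s
    using on_edge[OF that(1), of "(s + 1) / 2"] that(2) by (simp add: edge_pullback_def add_divide_distrib)
  ultimately show ?thesis by blast
qed

section \<open>Unisolvence\<close>

text \<open>Linearity of the degree of freedom in the test function. It is carried out on polynomial
  representatives, since the expansion of \<open>g\<close> in the basis holds only almost everywhere.\<close>

lemma dof_vanishes_imp_dof_span_vanishes:
  assumes poly: "polygon N v K" and "a < b" and w: "weight_function (-1) 1 w"
    and basis: "basis_AE (boundary_measure N v K) (piecewise_poly d N v K) n bs"
    and f: "f \<in> piecewise_poly e N v K"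
    and zero: "\<And>j. j \<in> {1..n} \<Longrightarrow> dof N v a b (w \<circ> rescale a b) (bs j) f = 0"
    and g: "g \<in> piecewise_poly d N v K"
  shows "dof N v a b (w \<circ> rescale a b) g f = 0"
proof -
  obtain F where F: "\<And>i. i \<in> {1..N} \<Longrightarrow>
      AE s in lborel. s \<in> {-1..1} \<longrightarrow> edge_pullback v i f s = poly (F i) s"
    using piecewise_poly_pullback[OF f] by metis
  \<comment> \<open>A polynomial that represents the \<open>j\<close>-th basis function on edge \<open>i\<close>.\<close>
  define B where "B j i = (SOME p. AE s in lborel. s \<in> {-1..1} \<longrightarrow>
      edge_pullback v i (bs j) s = poly p s)" for j i
  have B: "AE s in lborel. s \<in> {-1..1} \<longrightarrow> edge_pullback v i (bs j) s = poly (B j i) s"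
    if "j \<in> {1..n}" "i \<in> {1..N}" for j i
  proof -
    have "bs j \<in> piecewise_poly d N v K" using basis that(1) unfolding basis_AE_def by blast
    then have "\<exists>p. AE s in lborel. s \<in> {-1..1} \<longrightarrow> edge_pullback v i (bs j) s = poly p s"
      using piecewise_poly_pullback that(2) by blast
    then show ?thesis unfolding B_def by (rule someI_ex)
  qed
  obtain c where c: "AE x in boundary_measure N v K. g x = (\<Sum>j=1..n. c j * bs j x)"
    using basis g unfolding basis_AE_def by blast
  have G: "AE s in lborel. s \<in> {-1..1} \<longrightarrow>
      edge_pullback v i g s = poly (\<Sum>j=1..n. smult (c j) (B j i)) s" if i: "i \<in> {1..N}" for i
  proof -
    have "AE s in lborel. \<forall>j\<in>{1..n}. s \<in> {-1..1} \<longrightarrow> edge_pullback v i (bs j) s = poly (B j i) s"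
      by (intro AE_finite_allI) (use B i in auto)
    with AE_boundary_imp_AE_pullback[OF poly i c] show ?thesis
      by eventually_elim (auto simp: edge_pullback_def poly_sum intro!: sum.cong)
  qed
  let ?int = "\<lambda>j i. LINT s:{-1..1}|lebesgue. poly (F i * B j i) s * w s"
  have dof_bs: "dof N v a b (w \<circ> rescale a b) (bs j) f = (b - a) / 2 * (\<Sum>i=1..N. ?int j i)"
    if "j \<in> {1..n}" for j
    using that by (intro dof_of_poly_pullbacks[OF \<open>a < b\<close> w] F B)
  have "dof N v a b (w \<circ> rescale a b) g f = (b - a) / 2 *
      (\<Sum>i=1..N. LINT s:{-1..1}|lebesgue. poly (F i * (\<Sum>j=1..n. smult (c j) (B j i))) s * w s)"
    by (intro dof_of_poly_pullbacks[OF \<open>a < b\<close> w] F G)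
  also have "\<dots> = (b - a) / 2 * (\<Sum>i=1..N. \<Sum>j=1..n. c j * ?int j i)"
  proof -
    have "F i * (\<Sum>j=1..n. smult (c j) (B j i)) = (\<Sum>j=1..n. smult (c j) (F i * B j i))" for i
      by (simp add: sum_distrib_left)
    then show ?thesis by (simp only: weight_poly_integral_sum[OF w])
  qed
  also have "(\<Sum>i=1..N. \<Sum>j=1..n. c j * ?int j i) = (\<Sum>j=1..n. c j * (\<Sum>i=1..N. ?int j i))"
    by (subst sum.swap) (simp add: sum_distrib_left)
  also have "(b - a) / 2 * \<dots> = (\<Sum>j=1..n. c j * dof N v a b (w \<circ> rescale a b) (bs j) f)"
    using dof_bs by (simp add: sum_distrib_left mult.left_commute)
  also have "\<dots> = 0" using zero by simp
  finally show ?thesis .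
qed

text \<open>Testing with functions supported on edge \<open>i\<close> decouples the edges and gives orthogonality to all
  lower degrees on that edge.\<close>

lemma dof_zero_imp_pullback_multiple:
  assumes poly: "polygon N v K" and "a < b" and w: "weight_function (-1) 1 w"
    and orth: "orthogonal_polys (-1) 1 w \<pi>" and "1 \<le> m"
    and basis: "basis_AE (boundary_measure N v K) (piecewise_poly (m - 1) N v K) n bs"
    and f: "f \<in> piecewise_poly_cont m N v K"
    and zero: "\<And>j. j \<in> {1..n} \<Longrightarrow> dof N v a b (w \<circ> rescale a b) (bs j) f = 0"
    and i: "i \<in> {1..N}"
  shows "\<exists>c. \<forall>s\<in>{-1..1}. edge_pullback v i f s = c * poly (\<pi> m) s"
proof -
  obtain F where F: "\<And>i. i \<in> {1..N} \<Longrightarrow>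
      degree (F i) \<le> m \<and> (\<forall>s\<in>{-1..1}. edge_pullback v i f s = poly (F i) s)"
    using piecewise_poly_cont_pullback[OF poly f] by metis
  have "(LINT s:{-1..1}|lebesgue. poly (F i * q) s * w s) = 0" if "degree q < m" for q
  proof -
    have "degree q \<le> m - 1" using that by simp
    then obtain g where g: "g \<in> piecewise_poly (m - 1) N v K"
        "\<And>s. s \<in> {-1..1} \<Longrightarrow> edge_pullback v i g s = poly q s"
        "\<And>j. j \<in> {1..N} \<Longrightarrow> j \<noteq> i \<Longrightarrow> AE s in lborel. s \<in> {-1..1} \<longrightarrow> edge_pullback v j g s = 0"
      using exists_single_edge_poly[OF poly i] by blast
    have "0 = dof N v a b (w \<circ> rescale a b) g f"
      using f by (intro dof_vanishes_imp_dof_span_vanishes[OF poly \<open>a < b\<close> w basis _ zero g(1), symmetric])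
        (auto simp: piecewise_poly_cont_def)
    also have "\<dots> = (b - a) / 2 * (\<Sum>j=1..N. LINT s:{-1..1}|lebesgue.
        poly (F j * (if j = i then q else 0)) s * w s)"
      using F g(2,3) by (intro dof_of_poly_pullbacks[OF \<open>a < b\<close> w]) auto
    also have "(\<Sum>j=1..N. LINT s:{-1..1}|lebesgue. poly (F j * (if j = i then q else 0)) s * w s)
        = (\<Sum>j=1..N. if j = i then LINT s:{-1..1}|lebesgue. poly (F i * q) s * w s else 0)"
      by (intro sum.cong) (auto simp: set_lebesgue_integral_def)
    finally show ?thesis using i \<open>a < b\<close> by simp
  qed
  then obtain c where "F i = smult c (\<pi> m)"
    using orthogonal_to_lower_degree_imp_multiple[OF w orth \<open>1 \<le> m\<close>, of "F i"] F[OF i] by blast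
  with F[OF i] show ?thesis by auto
qed

lemma edge_pullback_endpoints:
  "edge_pullback v i f (- 1) = f (v i)" "edge_pullback v i f 1 = f (v (Suc i))"
  by (simp_all add: edge_pullback_def linepath_def)

lemma edge_pullback_zero_imp_zero:
  assumes poly: "polygon N v K"
    and zero: "\<And>i s. i \<in> {1..N} \<Longrightarrow> s \<in> {-1..1} \<Longrightarrow> edge_pullback v i f s = 0"
    and x: "x \<in> frontier K"
  shows "f x = 0"
proof -
  obtain i where i: "i \<in> {1..N}" and "x \<in> edge v i"
    using x unfolding polygon_frontier[OF poly] by blast
  then obtain t where t: "t \<in> {0..1}" "x = linepath (v i) (v (Suc i)) t"
    by (auto simp: edge_def in_segment linepath_def)
  then show ?thesis using zero[OF i, of "2 * t - 1"] by (simp add: edge_pullback_def)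
qed

lemma finite_element_iff_endpoints_differ:
  assumes poly: "polygon N v K" and "a < b" and w: "weight_function (-1) 1 w"
    and orth: "orthogonal_polys (-1) 1 w \<pi>" and "1 \<le> m" "even m"
    and basis: "basis_AE (boundary_measure N v K) (piecewise_poly (m - 1) N v K) (m * N) bs"
  shows "defines_finite_element (element_triple m N v K a b (w \<circ> rescale a b) bs)
    \<longleftrightarrow> poly (\<pi> m) 1 \<noteq> poly (\<pi> m) (- 1)"
proof
  have ends: "0 < poly (\<pi> m) (- 1) * poly (\<pi> m) 1"
    by (rule orthogonal_polys_endpoints_same_sign[OF w orth \<open>even m\<close>])
  have N: "3 \<le> N" "v (Suc N) = v 1" using poly by (auto simp: polygon_def)
  {
    assume fe: "defines_finite_element (element_triple m N v K a b (w \<circ> rescale a b) bs)"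
    show "poly (\<pi> m) 1 \<noteq> poly (\<pi> m) (- 1)"
    proof
      assume eq: "poly (\<pi> m) 1 = poly (\<pi> m) (- 1)"
      \<comment> \<open>The copy of \<open>\<pi>\<^sub>m\<close> on every edge is a nonzero function on which all degrees of freedom vanish.\<close>
      have "degree (\<pi> m) \<le> m" using orth by (simp add: orthogonal_polys_def)
      then obtain f where f: "f \<in> piecewise_poly_cont m N v K"
          "\<And>i s. i \<in> {1..N} \<Longrightarrow> s \<in> {-1..1} \<Longrightarrow> edge_pullback v i f s = poly (\<pi> m) s"
        using exists_repeated_edge_poly[OF poly _ eq[symmetric]] by blast
      have "dof N v a b (w \<circ> rescale a b) (bs j) f = 0" if j: "j \<in> {1..m * N}" for j
      proof -
        have bs: "bs j \<in> piecewise_poly (m - 1) N v K"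
          using basis j by (auto simp: basis_AE_def)
        obtain B where B: "\<And>i. i \<in> {1..N} \<Longrightarrow> degree (B i) \<le> m - 1 \<and>
            (AE s in lborel. s \<in> {-1..1} \<longrightarrow> edge_pullback v i (bs j) s = poly (B i) s)"
          using piecewise_poly_pullback[OF bs] by metis
        have "dof N v a b (w \<circ> rescale a b) (bs j) f
            = (b - a) / 2 * (\<Sum>i=1..N. LINT s:{-1..1}|lebesgue. poly (\<pi> m * B i) s * w s)"
          using f(2) B by (intro dof_of_poly_pullbacks[OF \<open>a < b\<close> w]) auto
        also have "(\<Sum>i=1..N. LINT s:{-1..1}|lebesgue. poly (\<pi> m * B i) s * w s) = 0"
        proof (intro sum.neutral ballI)
          fix i assume "i \<in> {1..N}"
          then have "degree (B i) < m" using B[of i] \<open>1 \<le> m\<close> by auto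
          then show "(LINT s:{-1..1}|lebesgue. poly (\<pi> m * B i) s * w s) = 0"
            by (rule orthogonal_polys_lower_degree[OF w orth])
        qed
        finally show ?thesis by (simp only: mult_zero_right)
      qed
      then have "\<forall>L\<in>(\<lambda>j. dof N v a b (w \<circ> rescale a b) (bs j)) ` {1..m * N}. L f = 0"
        by blast
      with fe f(1) have "\<forall>x\<in>frontier K. f x = 0"
        unfolding element_triple_def defines_finite_element.simps by blast
      moreover have "v 1 \<in> frontier K"
        using linepath_in_frontier[OF poly, of 1 0] N by (simp add: linepath_def)
      ultimately have "poly (\<pi> m) (- 1) = 0"
        using f(2)[of 1 "- 1"] N by (simp add: edge_pullback_endpoints)
      then show False using ends by simp
    qed
  }
  {
    assume neq: "poly (\<pi> m) 1 \<noteq> poly (\<pi> m) (- 1)"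
    have "f x = 0" if f: "f \<in> piecewise_poly_cont m N v K"
      and zero: "\<And>j. j \<in> {1..m * N} \<Longrightarrow> dof N v a b (w \<circ> rescale a b) (bs j) f = 0"
      and x: "x \<in> frontier K" for f x
    proof -
      have "\<exists>c. \<forall>s\<in>{-1..1}. edge_pullback v i f s = c * poly (\<pi> m) s" if "i \<in> {1..N}" for i
        using that
        by (intro dof_zero_imp_pullback_multiple[OF poly \<open>a < b\<close> w orth \<open>1 \<le> m\<close> basis f zero])
      then obtain c where c: "\<And>i s. i \<in> {1..N} \<Longrightarrow> s \<in> {-1..1} \<Longrightarrow>
          edge_pullback v i f s = c i * poly (\<pi> m) s"
        by metis
      \<comment> \<open>The factor that relates the values of \<open>f\<close> at the two ends of each edge.\<close>
      define \<rho> where "\<rho> = poly (\<pi> m) 1 / poly (\<pi> m) (- 1)"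
      have \<rho>: "0 < \<rho>" "\<rho> \<noteq> 1"
        using ends neq by (auto simp: \<rho>_def zero_less_mult_iff zero_less_divide_iff)
      have "poly (\<pi> m) (- 1) \<noteq> 0" using ends by auto
      have step: "f (v (Suc i)) = \<rho> * f (v i)" if "i \<in> {1..N}" for i
        using c[OF that, of "- 1"] c[OF that, of 1] \<open>poly (\<pi> m) (- 1) \<noteq> 0\<close>
        by (simp add: edge_pullback_endpoints \<rho>_def)
      have power: "f (v (Suc k)) = \<rho> ^ k * f (v 1)" if "k \<le> N" for k
        using that
      proof (induction k)
        case (Suc k)
        then show ?case using step[of "Suc k"] by simp
      qed simp
      have "\<rho> ^ N \<noteq> 1"
        using power_eq_imp_eq_base[of \<rho> N 1] \<rho> N by auto
      \<comment> \<open>After all \<open>N\<close> edges the walk is back at its starting vertex.\<close>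
      then have "f (v 1) = 0" using power[of N] N by simp
      then have "f (v (Suc k)) = 0" if "k \<le> N" for k
        using power[OF that] by simp
      then have vertex: "f (v i) = 0" if "i \<in> {1..N}" for i
        using that by (cases i) auto
      have "c i = 0" if "i \<in> {1..N}" for i
        using c[OF that, of "- 1"] vertex[OF that] \<open>poly (\<pi> m) (- 1) \<noteq> 0\<close>
        by (simp add: edge_pullback_endpoints)
      then show ?thesis
        using c x by (auto intro: edge_pullback_zero_imp_zero[OF poly, where f = f])
    qed
    then show "defines_finite_element (element_triple m N v K a b (w \<circ> rescale a b) bs)"
      unfolding element_triple_def defines_finite_element.simps by blast
  }
qed

section \<open>Values of the orthogonal polynomial at the end points\<close>

lemma poly_endpoint_difference:
  fixes p :: "real poly"
  assumes "degree p \<le> m"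
  shows "poly p 1 - poly p (- 1) = 2 * (\<Sum>\<nu> | \<nu> \<le> m \<and> odd \<nu>. coeff p \<nu>)"
proof -
  have "poly p x = (\<Sum>\<nu>\<le>m. coeff p \<nu> * x ^ \<nu>)" for x
    unfolding poly_altdef using assms
    by (intro sum.mono_neutral_left) (auto simp: coeff_eq_0)
  then have "poly p 1 - poly p (- 1) = (\<Sum>\<nu>\<le>m. coeff p \<nu> * (1 - (- 1) ^ \<nu>))"
    by (simp add: sum_subtractf right_diff_distrib)
  also have "\<dots> = (\<Sum>\<nu>\<le>m. if odd \<nu> then 2 * coeff p \<nu> else 0)"
    by (intro sum.cong) auto
  also have "\<dots> = (\<Sum>\<nu> \<in> {..m} \<inter> {\<nu>. odd \<nu>}. 2 * coeff p \<nu>)"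
    by (subst sum.inter_restrict) auto
  also have "{..m} \<inter> {\<nu>. odd \<nu>} = {\<nu>. \<nu> \<le> m \<and> odd \<nu>}"
    by auto
  also have "(\<Sum>\<nu> | \<nu> \<le> m \<and> odd \<nu>. 2 * coeff p \<nu>)
      = 2 * (\<Sum>\<nu> | \<nu> \<le> m \<and> odd \<nu>. coeff p \<nu>)"
    by (simp only: sum_distrib_left)
  finally show ?thesis .
qed

lemma rescaled_poly_endpoints:
  assumes "a < b"
  shows "rescaled_poly \<pi> m a b a = poly (\<pi> m) (- 1)" "rescaled_poly \<pi> m a b b = poly (\<pi> m) 1"
proof -
  have "rescale a b a = - 1" "rescale a b b = 1"
    using assms by (simp_all add: rescale_def field_simps)
  then show "rescaled_poly \<pi> m a b a = poly (\<pi> m) (- 1)" "rescaled_poly \<pi> m a b b = poly (\<pi> m) 1"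
    by (simp_all add: rescaled_poly_def)
qed

lemma integral_deriv_rescaled_poly:
  assumes "a < b"
  shows "(LINT x:{a..b}|lebesgue. deriv (rescaled_poly \<pi> m a b) x)
    = rescaled_poly \<pi> m a b b - rescaled_poly \<pi> m a b a"
proof -
  define q where "q = pcompose (\<pi> m) [:(a + b) / (a - b), - 2 / (a - b):]"
  have eq: "rescaled_poly \<pi> m a b = poly q"
    by (rule ext) (simp add: rescaled_poly_def rescale_def q_def poly_pcompose
        add_divide_distrib diff_divide_distrib mult.commute)
  have deriv: "deriv (poly q) x = poly (pderiv q) x" for x
    by (rule DERIV_imp_deriv) (rule poly_DERIV)
  have "set_integrable lebesgue {a..b} (poly (pderiv q))"
  proof -
    have "set_integrable lborel {a..b} (poly (pderiv q))"
      by (rule borel_integrable_atLeastAtMost') (intro continuous_intros)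
    then show ?thesis
      unfolding set_integrable_def by (simp add: integrable_completion borel_measurable_integrable)
  qed
  then have "(LINT x:{a..b}|lebesgue. poly (pderiv q) x) = integral {a..b} (poly (pderiv q))"
    by (rule set_lebesgue_integral_eq_integral(2))
  also have "\<dots> = poly q b - poly q a"
    using assms
    by (intro integral_unique fundamental_theorem_of_calculus)
       (auto simp flip: has_real_derivative_iff_has_vector_derivative
         intro: has_field_derivative_at_within poly_DERIV)
  finally show ?thesis by (simp add: eq deriv)
qed

theorem corollary3:
  fixes m N :: nat and v :: "nat \<Rightarrow> real^2" and K :: "(real^2) set"
    and \<omega> :: "real \<Rightarrow> real" and \<pi> :: "nat \<Rightarrow> real poly" and a b :: real
    and bs :: "nat \<Rightarrow> real^2 \<Rightarrow> real"
  assumes "1 \<le> m" and "even m"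
    and "polygon N v K"
    and "weight_function (-1) 1 \<omega>"
    and "orthogonal_polys (-1) 1 \<omega> \<pi>"
    and "a < b"
    and "basis_AE (boundary_measure N v K) (piecewise_poly (m - 1) N v K) (m * N) bs"
  shows
    "(defines_finite_element (element_triple m N v K a b (\<omega> \<circ> rescale a b) bs)
        \<longleftrightarrow> rescaled_poly \<pi> m a b b - rescaled_poly \<pi> m a b a \<noteq> 0) \<and>
     (rescaled_poly \<pi> m a b b - rescaled_poly \<pi> m a b a \<noteq> 0
        \<longleftrightarrow> (LINT x:{a..b}|lebesgue. deriv (rescaled_poly \<pi> m a b) x) \<noteq> 0) \<and>
     ((LINT x:{a..b}|lebesgue. deriv (rescaled_poly \<pi> m a b) x) \<noteq> 0
        \<longleftrightarrow> (\<Sum>\<nu> | \<nu> \<le> m \<and> odd \<nu>. coeff (\<pi> m) \<nu>) \<noteq> 0)"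
proof -
  have "degree (\<pi> m) \<le> m" using assms(5) by (simp add: orthogonal_polys_def)
  note diff = poly_endpoint_difference[OF this]
  have fe: "defines_finite_element (element_triple m N v K a b (\<omega> \<circ> rescale a b) bs)
      \<longleftrightarrow> poly (\<pi> m) 1 - poly (\<pi> m) (- 1) \<noteq> 0"
    using finite_element_iff_endpoints_differ[OF assms(3,6,4,5,1,2,7)] by simp
  show ?thesis
    unfolding fe integral_deriv_rescaled_poly[OF \<open>a < b\<close>] rescaled_poly_endpoints[OF \<open>a < b\<close>] diff
    by simp
qed

end
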